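(* Let $R>1$, $1\le r<R$ and suppose that $f(z)=\sum_{p=0}^\infty c_p z^p$ for all $|z|<R$. Then for every $\alpha\in[0,1]$, $$\lim_{n\to\infty} n\left(G_n^\alpha(f;z)-f(z)\right)=z(1-z)f''(z)\quad\text{uniformly for } z\in\overline{D}_r .$$
   Context: $\mathbb{N}=\{1,2,3,\dots\}$; $D_R=\{z\in\mathbb{C}:|z|<R\}$ and $\overline{D}_r=\{z\in\mathbb{C}:|z|\le r\}$. For $0\le k\le n$ let $p_{n,k}(t)=\binom{n}{k}t^k(1-t)^{n-k}$. For $\alpha\in[0,1]$ the $\alpha$-Bernstein polynomials are $q_{1,0}^\alpha(z)=1-z$, $q_{1,1}^\alpha(z)=z$ and, for $n\ge2$, $0\le k\le n$, $$q_{n,k}^\alpha(z)=\left[\binom{n-2}{k}(1-\alpha)z+\binom{n-2}{k-2}(1-\alpha)(1-z)+\binom{n}{k}\alpha z(1-z)\right]z^{k-1}(1-z)^{n-k-1},$$ where $\binom{m}{j}=0$ if $j<0$ or $j>m$, and the expression is understood as a polynomial in $z$ after cancellation (e.g. $q_{n,0}^\alpha(z)=(1-\alpha)(1-z)^{n-1}+\alpha(1-z)^n$ and $q_{n,n}^\alpha(z)=(1-\alpha)z^{n-1}+\alpha z^n$). For $n\in\mathbb{N}$, $\alpha\in[0,1]$, $z\in\mathbb{C}$ and $f$ a complex-valued analytic function in $D_R$ with $R>1$, the complex genuine $\alpha$-Bernstein-Durrmeyer operator is $$G_n^\alpha(f;z)=q_{n,0}^\alpha(z)f(0)+q_{n,n}^\alpha(z)f(1)+(n-1)\sum_{k=1}^{n-1}q_{n,k}^\alpha(z)\int_0^1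 p_{n-2,k-1}(t)f(t)\,dt$$ (the sum is empty for $n=1$). *)

theory Defs
  imports "HOL-Analysis.Analysis"
begin

text \<open>
  The polynomial \<open>q\<^sub>n\<^sub>,\<^sub>k\<^sup>\<alpha>\<close>, with the factor \<open>z ^ (k - 1) * (1 - z) ^ (n - k - 1)\<close> multiplied out
  so that no negative exponents remain. In the first term \<open>n - k - 1\<close> is truncated only if
  \<open>k \<ge> n\<close>, where the binomial coefficient vanishes. The guard on the second term is needed because
  the truncated \<open>k - 2\<close> would turn a lower index \<open>-2\<close> or \<open>-1\<close> into \<open>0\<close>.
  Only \<open>n \<ge> 1\<close> and \<open>k \<le> n\<close> are meaningful.
\<close>

definition alpha_Bernstein :: "real \<Rightarrow> nat \<Rightarrow> nat \<Rightarrow> complex \<Rightarrow> complex" where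
  "alpha_Bernstein \<alpha> n k z =
     (if n = 1 then (if k = 0 then 1 - z else z)
      else of_nat ((n - 2) choose k) * of_real (1 - \<alpha>) * z ^ k * (1 - z) ^ (n - k - 1)
         + (if k \<ge> 2 then of_nat ((n - 2) choose (k - 2)) * of_real (1 - \<alpha>) * z ^ (k - 1) * (1 - z) ^ (n - k)
            else 0)
         + of_nat (n choose k) * of_real \<alpha> * z ^ k * (1 - z) ^ (n - k))"

text \<open>The uncancelled form, valid away from the zeros of \<open>z\<close> and \<open>1 - z\<close>.\<close>

lemma alpha_Bernstein_powi:
  assumes "n \<ge> 2" "k \<le> n" "z \<noteq> 0" "z \<noteq> 1"
  shows "alpha_Bernstein \<alpha> n k z =
     (of_nat ((n - 2) choose k) * of_real (1 - \<alpha>) * z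
      + (if k \<ge> 2 then of_nat ((n - 2) choose (k - 2)) else 0) * of_real (1 - \<alpha>) * (1 - z)
      + of_nat (n choose k) * of_real \<alpha> * z * (1 - z))
     * z powi (int k - 1) * (1 - z) powi (int n - int k - 1)"
proof -
  have w: "1 - z \<noteq> 0" using assms by simp
  have z1: "z powi (int k - 1) = z ^ k / z"
    using assms by (simp add: power_int_diff)
  have z2: "(1 - z) powi (int n - int k - 1) = (1 - z) ^ (n - k) / (1 - z)"
    using assms w by (simp add: power_int_diff power_diff)
  have A: "of_nat ((n - 2) choose k) * (1 - z) ^ (n - k - 1)
      = of_nat ((n - 2) choose k) * ((1 - z) ^ (n - k) / (1 - z))"
  proof (cases "k < n")
    case True
    then have "(1 - z) ^ (n - k) = (1 - z) * (1 - z) ^ (n - k - 1)"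
      by (metis Suc_diff_Suc diff_Suc_eq_diff_pred diff_commute power_Suc One_nat_def diff_Suc_1)
    then show ?thesis using w by simp
  next
    case False
    then have "(n - 2) choose k = 0" using assms by (intro binomial_eq_0) auto
    then show ?thesis by (simp only: of_nat_0 mult_zero_left)
  qed
  have B: "z ^ (k - 1) = z ^ k / z" if "k \<ge> 2"
    using that assms by (simp add: power_diff)
  have "alpha_Bernstein \<alpha> n k z =
      of_real (1 - \<alpha>) * z ^ k * (of_nat ((n - 2) choose k) * (1 - z) ^ (n - k - 1))
      + (if k \<ge> 2 then of_nat ((n - 2) choose (k - 2)) * of_real (1 - \<alpha>) * z ^ (k - 1) * (1 - z) ^ (n - k)
         else 0)
      + of_nat (n choose k) * of_real \<alpha> * z ^ k * (1 - z) ^ (n - k)"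
    using assms unfolding alpha_Bernstein_def by (simp add: mult_ac)
  also have "\<dots> = of_real (1 - \<alpha>) * z ^ k * (of_nat ((n - 2) choose k) * ((1 - z) ^ (n - k) / (1 - z)))
      + (if k \<ge> 2 then of_nat ((n - 2) choose (k - 2)) else 0) * of_real (1 - \<alpha>)
          * (z ^ k / z) * (1 - z) ^ (n - k)
      + of_nat (n choose k) * of_real \<alpha> * z ^ k * (1 - z) ^ (n - k)"
    unfolding A using B by (cases "k \<ge> 2") simp_all
  also have "\<dots> = (of_nat ((n - 2) choose k) * of_real (1 - \<alpha>) * z
      + (if k \<ge> 2 then of_nat ((n - 2) choose (k - 2)) else 0) * of_real (1 - \<alpha>) * (1 - z)
      + of_nat (n choose k) * of_real \<alpha> * z * (1 - z))
     * (z ^ k / z) * ((1 - z) ^ (n - k) / (1 - z))"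
    (is "?a * ?Z * (?b * (?W / _)) + ?c * ?a * (?Z / z) * ?W + ?d * ?e * ?Z * ?W = _")
  proof -
    have "a * Z * (b * (W / w)) + c * a * (Z / z) * W + d * e * Z * W
        = (b * a * z + c * a * w + d * e * z * w) * (Z / z) * (W / w)"
      if "w \<noteq> 0" for a b c d e Z W w :: complex
      using that assms(3) by (simp add: field_simps)
    from this[OF w] show ?thesis .
  qed
  finally show ?thesis unfolding z1 z2 .
qed

text \<open>
  The basis polynomials \<open>p\<^sub>n\<^sub>,\<^sub>k\<close> under the integral are the library's \<^const>\<open>Bernstein\<close>.
\<close>

definition genuine_Bernstein_Durrmeyer ::
    "real \<Rightarrow> nat \<Rightarrow> (complex \<Rightarrow> complex) \<Rightarrow> complex \<Rightarrow> complex" where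
  "genuine_Bernstein_Durrmeyer \<alpha> n f z =
     alpha_Bernstein \<alpha> n 0 z * f 0 + alpha_Bernstein \<alpha> n n z * f 1
     + of_nat (n - 1) * (\<Sum>k = 1..n - 1. alpha_Bernstein \<alpha> n k z *
         integral {0..1} (\<lambda>t. of_real (Bernstein (n - 2) (k - 1) t) * f (of_real t)))"

end

theory Submission
  imports Defs
begin

text \<open>
  By the Beta integral the operator maps \<open>z ^ p\<close> to the \<open>q\<^sub>n\<^sub>,\<^sub>k\<^sup>\<alpha>\<close>-average of the quotients
  \<open>(k)\<^sub>p / (n)\<^sub>p\<close> of rising factorials. For \<open>\<alpha> = 1\<close> Vandermonde's identity turns this average into a
  convex combination of \<open>1, z, \<dots>, z ^ p\<close> whose two top weights are explicit:
  \<open>1 - p (p - 1) / n\<close> and \<open>p (p - 1) / n\<close> up to \<open>o(1 / n)\<close>. Since the weights sum to \<open>1\<close>, the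
  remaining ones are \<open>o(1 / n)\<close> together, so \<open>n (G\<^sub>n z ^ p - z ^ p)\<close> tends to
  \<open>p (p - 1) z ^ (p - 1) (1 - z)\<close> with an error of at most \<open>3 p (p - 1) r ^ p\<close> for every \<open>n\<close>. Passing
  to general \<open>\<alpha>\<close> adds \<open>(1 - \<alpha>) z (1 - z)\<close> times the average of a second difference of
  \<open>(k)\<^sub>p / (n)\<^sub>p\<close>, which contributes \<open>O(p (p - 1) r ^ p / n)\<close> after multiplication by \<open>n\<close>. The
  errors are dominated by the absolutely convergent series of \<open>f''\<close>, so Tannery's theorem allows
  summing them against the coefficients of \<open>f\<close>.
\<close>

section \<open>Bernstein sums of binomial coefficients and rising factorials\<close>

text \<open>The node values are given directly, not as a function evaluated at \<open>k / m\<close>,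
  so one sequence \<open>g\<close> and its shifts can serve the two degrees \<open>m\<close> and
  \<open>m + 2\<close>.\<close>

definition Bernstein_sum :: "nat \<Rightarrow> (nat \<Rightarrow> 'a) \<Rightarrow> 'a \<Rightarrow> 'a::comm_ring_1" where
  "Bernstein_sum m g z = (\<Sum>k\<le>m. of_nat (m choose k) * z ^ k * (1 - z) ^ (m - k) * g k)"

text \<open>Binomial moments of the binomial distribution: trinomial revision pulls
  \<open>m choose j\<close> and \<open>z ^ j\<close> out of the sum, and what remains is the
  expansion of \<open>(z + (1 - z)) ^ (m - j)\<close>.\<close>

lemma Bernstein_sum_choose:
  "Bernstein_sum m (\<lambda>k. of_nat (k choose j)) z = of_nat (m choose j) * z ^ j"
proof (cases "j \<le> m")
  case False
  then show ?thesis
    by (auto simp: Bernstein_sum_def binomial_eq_0)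
next
  case True
  have "Bernstein_sum m (\<lambda>k. of_nat (k choose j)) z
      = (\<Sum>k=j..m. of_nat (m choose k) * z ^ k * (1 - z) ^ (m - k) * of_nat (k choose j))"
    unfolding Bernstein_sum_def by (rule sum.mono_neutral_right) (auto simp: binomial_eq_0)
  also have "\<dots> = (\<Sum>k=j..m. of_nat (m choose j) * z ^ j *
                   (of_nat ((m - j) choose (k - j)) * z ^ (k - j) * (1 - z) ^ (m - k)))"
  proof (rule sum.cong)
    fix k assume k: "k \<in> {j..m}"
    then have "(m choose k) * (k choose j) = (m choose j) * ((m - j) choose (k - j))"
      by (intro choose_mult) auto
    then have "of_nat (m choose k) * of_nat (k choose j)
        = (of_nat (m choose j) * of_nat ((m - j) choose (k - j)) :: 'a)"
      by (metis of_nat_mult)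
    moreover have "z ^ k = z ^ j * z ^ (k - j)"
      using k by (simp flip: power_add)
    moreover have "of_nat (m choose k) * z ^ k * (1 - z) ^ (m - k) * of_nat (k choose j)
        = of_nat (m choose k) * of_nat (k choose j) * z ^ k * (1 - z) ^ (m - k)"
      by (simp only: mult_ac)
    ultimately have "of_nat (m choose k) * z ^ k * (1 - z) ^ (m - k) * of_nat (k choose j) =
        of_nat (m choose j) * of_nat ((m - j) choose (k - j)) * (z ^ j * z ^ (k - j)) * (1 - z) ^ (m - k)"
      by simp
    then show "of_nat (m choose k) * z ^ k * (1 - z) ^ (m - k) * of_nat (k choose j) =
        of_nat (m choose j) * z ^ j *
        (of_nat ((m - j) choose (k - j)) * z ^ (k - j) * (1 - z) ^ (m - k))"
      by (simp only: mult_ac)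
  qed simp
  also have "\<dots> = of_nat (m choose j) * z ^ j *
      (\<Sum>k\<le>m - j. of_nat ((m - j) choose k) * z ^ k * (1 - z) ^ (m - j - k))"
    unfolding sum_distrib_left
    by (rule sum.reindex_bij_witness[of _ "\<lambda>k. k + j" "\<lambda>k. k - j"]) (use True in auto)
  also have "(\<Sum>k\<le>m - j. of_nat ((m - j) choose k) * z ^ k * (1 - z) ^ (m - j - k)) = 1"
    using binomial_ring[of z "1 - z" "m - j"] by simp
  finally show ?thesis by simp
qed

text \<open>The rising factorial is \<open>fact p * ((k + q) choose p)\<close> with q = s + p - 1,
  written additively to avoid truncated subtraction; Vandermonde then splits
  \<open>k + q\<close>.\<close>

lemma pochhammer_nat_eq_sum:
  assumes "s + p = Suc q"
  shows "pochhammer (k + s) p = fact p * (\<Sum>j\<le>p. (k choose j) * (q choose (p - j)))"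
proof -
  have "real (k + s) = real (k + q) - real p + 1"
    using assms by linarith
  then have "real (pochhammer (k + s) p) = fact p * (real (k + q) gchoose p)"
    unfolding gbinomial_pochhammer' pochhammer_of_nat[symmetric] by (simp only:) simp
  then have "real (pochhammer (k + s) p) = real (fact p * ((k + q) choose p))"
    by (simp add: binomial_gbinomial)
  then show ?thesis
    unfolding vandermonde of_nat_eq_iff .
qed

lemma Bernstein_sum_sum:
  "Bernstein_sum m (\<lambda>k. \<Sum>i\<in>A. g i k) z = (\<Sum>i\<in>A. Bernstein_sum m (g i) z)"
  unfolding Bernstein_sum_def sum_distrib_left by (rule sum.swap)

lemma Bernstein_sum_scale: "Bernstein_sum m (\<lambda>k. c * g k) z = c * Bernstein_sum m g z"
  unfolding Bernstein_sum_def sum_distrib_left by (simp add: mult_ac)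

lemma Bernstein_sum_add:
  "Bernstein_sum m (\<lambda>k. g k + h k) z = Bernstein_sum m g z + Bernstein_sum m h z"
  by (simp add: Bernstein_sum_def algebra_simps sum.distrib)

lemma Bernstein_sum_diff:
  "Bernstein_sum m (\<lambda>k. g k - h k) z = Bernstein_sum m g z - Bernstein_sum m h z"
  by (simp add: Bernstein_sum_def algebra_simps sum_subtractf)

lemma Bernstein_sum_pochhammer:
  assumes "s + p = Suc q"
  shows "Bernstein_sum m (\<lambda>k. of_nat (pochhammer (k + s) p)) z =
    (\<Sum>j\<le>p. of_nat (fact p * (q choose (p - j)) * (m choose j)) * z ^ j)"
proof -
  have "Bernstein_sum m (\<lambda>k. of_nat (pochhammer (k + s) p)) z =
      Bernstein_sum m (\<lambda>k. \<Sum>j\<le>p. of_nat (fact p * (q choose (p - j))) * of_nat (k choose j)) z"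
    unfolding pochhammer_nat_eq_sum[OF assms]
    by (simp add: sum_distrib_left mult_ac)
  then show ?thesis
    unfolding Bernstein_sum_sum Bernstein_sum_scale Bernstein_sum_choose by (simp add: mult_ac)
qed

text \<open>All coefficients of the powers of \<open>z\<close> are nonnegative, each power is at
  most \<open>r ^ p\<close> in norm, and Vandermonde with \<open>m\<close> in place of
  \<open>k\<close> evaluates the sum of the coefficients.\<close>

lemma norm_Bernstein_sum_pochhammer_le:
  fixes z :: "'a::{real_normed_algebra_1,comm_ring_1}"
  assumes "s + p = Suc q" "norm z \<le> r" "1 \<le> r"
  shows "norm (Bernstein_sum m (\<lambda>k. of_nat (pochhammer (k + s) p)) z)
    \<le> r ^ p * real (pochhammer (m + s) p)"
proof -
  have "norm (of_nat (fact p * (q choose (p - j)) * (m choose j)) * z ^ j)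
      \<le> r ^ p * real (fact p * ((m choose j) * (q choose (p - j))))" if "j \<le> p" for j
  proof -
    have "norm (z ^ j) \<le> r ^ j"
      by (meson assms norm_power_ineq norm_ge_zero order_trans power_mono)
    also have "\<dots> \<le> r ^ p" using assms that by (simp add: power_increasing)
    finally have "norm (of_nat (fact p * (q choose (p - j)) * (m choose j)) * z ^ j)
       \<le> real (fact p * (q choose (p - j)) * (m choose j)) * r ^ p"
      by (intro order_trans[OF norm_mult_ineq] mult_mono) (simp_all only: norm_of_nat norm_ge_zero of_nat_0_le_iff order_refl)
    then show ?thesis by (simp add: mult_ac)
  qed
  then have "norm (\<Sum>j\<le>p. of_nat (fact p * (q choose (p - j)) * (m choose j)) * z ^ j)
      \<le> (\<Sum>j\<le>p. r ^ p * real (fact p * ((m choose j) * (q choose (p - j)))))"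
    by (intro sum_norm_le) simp
  then show ?thesis
    unfolding Bernstein_sum_pochhammer[OF assms(1)]
    unfolding pochhammer_nat_eq_sum[OF assms(1)] sum_distrib_left of_nat_sum .
qed

text \<open>Pascal's rule; probabilistically, conditioning on one of \<open>Suc m\<close>
  trials.\<close>

lemma Bernstein_sum_Suc:
  "Bernstein_sum (Suc m) g z =
    (1 - z) * Bernstein_sum m g z + z * Bernstein_sum m (\<lambda>k. g (Suc k)) z"
proof -
  have "Bernstein_sum (Suc m) g z = (1 - z) ^ Suc m * g 0 +
     (\<Sum>k\<le>m. of_nat (Suc m choose Suc k) * z ^ Suc k * (1 - z) ^ (m - k) * g (Suc k))"
    unfolding Bernstein_sum_def by (subst sum.atMost_Suc_shift) simp
  also have "\<dots> = ((1 - z) ^ Suc m * g 0 +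
     (\<Sum>k\<le>m. of_nat (m choose Suc k) * z ^ Suc k * (1 - z) ^ (m - k) * g (Suc k)))
     + z * Bernstein_sum m (\<lambda>k. g (Suc k)) z"
    by (simp add: Bernstein_sum_def algebra_simps sum.distrib sum_distrib_left)
  \<comment> \<open>The unshifted half of Pascal's rule is the sum of degree \<open>m\<close> with
    one more factor \<open>1 - z\<close>; the extra term at \<open>k = Suc m\<close> has binomial
    coefficient zero.\<close>
  also have "(1 - z) ^ Suc m * g 0 +
     (\<Sum>k\<le>m. of_nat (m choose Suc k) * z ^ Suc k * (1 - z) ^ (m - k) * g (Suc k))
     = (\<Sum>k\<le>Suc m. of_nat (m choose k) * z ^ k * (1 - z) ^ (Suc m - k) * g k)"
    by (simp add: sum.atMost_Suc_shift del: sum.atMost_Suc)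
  also have "\<dots> = (1 - z) * Bernstein_sum m g z"
    unfolding Bernstein_sum_def sum_distrib_left sum.atMost_Suc
    by (simp add: Suc_diff_le mult_ac binomial_eq_0)
  finally show ?thesis .
qed

section \<open>Reduction to Bernstein sums and termwise action on a power series\<close>

text \<open>The two terms carrying \<open>1 - \<alpha>\<close> sum to \<open>(1 - z)\<close> and
  \<open>z\<close> times the degree \<open>m\<close> sums of \<open>g k\<close> and
  \<open>g (k + 2)\<close>. Subtracting the sum of degree \<open>m + 2\<close>, reduced to degree
  \<open>m\<close> by applying Pascal's rule twice, leaves \<open>z * (1 - z)\<close> times a second
  difference.\<close>

lemma sum_alpha_Bernstein:
  "(\<Sum>k\<le>m + 2. alpha_Bernstein \<alpha> (m + 2) k z * g k) =
    Bernstein_sum (m + 2) g z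
    + of_real (1 - \<alpha>) * z * (1 - z) * Bernstein_sum m (\<lambda>k. g k - 2 * g (k + 1) + g (k + 2)) z"
proof -
  have A: "(\<Sum>k\<le>m + 2. of_nat (m choose k) * z ^ k * (1 - z) ^ (m + 2 - k - 1) * g k)
      = (1 - z) * Bernstein_sum m g z"
    unfolding Bernstein_sum_def sum_distrib_left
    by (rule sum.mono_neutral_cong_right) (auto simp: Suc_diff_le)
  have B: "(\<Sum>k\<le>m + 2. (if k \<ge> 2 then of_nat (m choose (k - 2)) * z ^ (k - 1) * (1 - z) ^ (m + 2 - k) else 0) * g k)
      = z * Bernstein_sum m (\<lambda>k. g (k + 2)) z"
    unfolding Bernstein_sum_def sum_distrib_left
    by (simp add: numeral_2_eq_2 sum.atMost_Suc_shift del: sum.atMost_Suc)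
       (simp add: mult_ac)
  have C: "Bernstein_sum (m + 2) g z = (1 - z) * (1 - z) * Bernstein_sum m g z
     + 2 * z * (1 - z) * Bernstein_sum m (\<lambda>k. g (k + 1)) z + z * z * Bernstein_sum m (\<lambda>k. g (k + 2)) z"
    by (simp add: Bernstein_sum_Suc numeral_2_eq_2 algebra_simps)
  have D: "Bernstein_sum m (\<lambda>k. g k - 2 * g (k + 1) + g (k + 2)) z = Bernstein_sum m g z
     - 2 * Bernstein_sum m (\<lambda>k. g (k + 1)) z + Bernstein_sum m (\<lambda>k. g (k + 2)) z"
    unfolding Bernstein_sum_add Bernstein_sum_diff Bernstein_sum_scale ..
  have "alpha_Bernstein \<alpha> (m + 2) k z * g k =
     of_real (1 - \<alpha>) * (of_nat (m choose k) * z ^ k * (1 - z) ^ (m + 2 - k - 1) * g k)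
     + of_real (1 - \<alpha>) * ((if k \<ge> 2 then of_nat (m choose (k - 2)) * z ^ (k - 1) * (1 - z) ^ (m + 2 - k) else 0) * g k)
     + of_real \<alpha> * (of_nat (m + 2 choose k) * z ^ k * (1 - z) ^ (m + 2 - k) * g k)" for k
    by (simp add: alpha_Bernstein_def algebra_simps)
  then have "(\<Sum>k\<le>m + 2. alpha_Bernstein \<alpha> (m + 2) k z * g k) =
     of_real (1 - \<alpha>) * ((1 - z) * Bernstein_sum m g z)
     + of_real (1 - \<alpha>) * (z * Bernstein_sum m (\<lambda>k. g (k + 2)) z)
     + of_real \<alpha> * Bernstein_sum (m + 2) g z"
    unfolding A[symmetric] B[symmetric]
    by (simp only: sum.distrib sum_distrib_left Bernstein_sum_def)
  then show ?thesis unfolding C D by (simp add: algebra_simps)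
qed

text \<open>Up to the binomial coefficient this is the Beta integral with parameters j + p + 1 and m
  - j + 1. In the operator m = n - 2 and j = k - 1, so the quotient is
  \<open>pochhammer k p / pochhammer n p\<close> divided by n - 1.\<close>

lemma Bernstein_moment:
  assumes "j \<le> m"
  shows "((\<lambda>t. of_real (Bernstein m j t) * of_real t ^ p) has_integral
     (of_nat (pochhammer (Suc j) p) / (of_nat (Suc m) * of_nat (pochhammer (m + 2) p)) :: complex)) {0..1}"
proof -
  have "((\<lambda>t. t powr (real (Suc (j + p)) - 1) * (1 - t) powr (real (Suc (m - j)) - 1)) has_integral
      Beta (real (Suc (j + p))) (real (Suc (m - j)))) {0..1}"
    by (rule has_integral_Beta_real) auto
  \<comment> \<open>The endpoints are exempted because \<open>powr\<close> and \<open>^\<close> can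
    differ there: \<open>0 powr 0\<close> is 0, but \<open>0 ^ 0\<close> is 1.\<close>
  then have I: "((\<lambda>t. t ^ (j + p) * (1 - t) ^ (m - j)) has_integral
      Beta (real (Suc (j + p))) (real (Suc (m - j)))) {0..1}"
    by (rule has_integral_spike_finite[where S = "{0, 1}", rotated 2]) (auto simp: less_le simp flip: powr_realpow)
  have fact: "fact (i + p) = fact i * real (pochhammer (Suc i) p)" for i
    using pochhammer_product'[of "1::real" i p]
    by (simp add: pochhammer_fact pochhammer_of_nat[symmetric] add_ac)
  have "Beta (real (Suc (j + p))) (real (Suc (m - j))) = fact (j + p) * fact (m - j) / fact (Suc m + p)"
    unfolding Beta_def using assms Gamma_fact[of "j + p", where 'a = real]
      Gamma_fact[of "m - j", where 'a = real] Gamma_fact[of "Suc m + p", where 'a = real]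
    by (simp add: of_nat_diff add_ac)
  moreover have "real (m choose j) * (fact (j + p) * fact (m - j) / fact (Suc m + p)) =
     real (pochhammer (Suc j) p) / (real (Suc m) * real (pochhammer (m + 2) p))"
    unfolding fact binomial_fact[OF assms] by (simp add: divide_simps)
  ultimately have "real (m choose j) * Beta (real (Suc (j + p))) (real (Suc (m - j))) =
     real (pochhammer (Suc j) p) / (real (Suc m) * real (pochhammer (m + 2) p))"
    by (simp only:)
  then have "((\<lambda>t. Bernstein m j t * t ^ p) has_integral
     real (pochhammer (Suc j) p) / (real (Suc m) * real (pochhammer (m + 2) p))) {0..1}"
    using has_integral_mult_right[OF I, of "real (m choose j)"]
    by (simp add: Bernstein_def power_add mult_ac)
  from has_integral_of_real[OF this, where 'b = complex] show ?thesis
    by simp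
qed


text \<open>Each functional multiplying a basis polynomial can be applied to the series term by
  term. The two point evaluations fit the same quotient of rising factorials as the integrals: it is
  \<open>0 ^ p\<close> at \<open>k = 0\<close> and 1 at \<open>k = m + 2\<close>.\<close>

lemma genuine_Bernstein_Durrmeyer_sums:
  assumes "R > 1" and f: "\<And>z. norm z < R \<Longrightarrow> (\<lambda>p. c p * z ^ p) sums f z"
  shows "(\<lambda>p. c p * (\<Sum>k\<le>m + 2. alpha_Bernstein \<alpha> (m + 2) k z *
             (of_nat (pochhammer k p) / of_nat (pochhammer (m + 2) p))))
    sums genuine_Bernstein_Durrmeyer \<alpha> (m + 2) f z"
proof -
  define L where "L k = (if k = 0 then f 0 else if k = m + 2 then f 1 else of_nat (m + 1) *
    integral {0..1} (\<lambda>t. of_real (Bernstein m (k - 1) t) * f (of_real t)))" for k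
  have poch_pos: "pochhammer (m + 2) p > 0" for p
    by (rule pochhammer_pos) simp
  have "(\<lambda>p. c p * (of_nat (pochhammer k p) / of_nat (pochhammer (m + 2) p))) sums L k"
    if k: "k \<le> m + 2" for k
  proof -
    have "k = 0 \<or> k = m + 2 \<or> k = Suc (k - 1) \<and> k - 1 \<le> m"
      using k by linarith
    then consider "k = 0" | "k = m + 2" | j where "k = Suc j" "j \<le> m"
      by blast
    then show ?thesis
    proof cases
      case 1
      have "of_nat (pochhammer (0::nat) p) / of_nat (pochhammer (m + 2) p) = (0::complex) ^ p" for p
        by (cases p) (auto simp: pochhammer_0_left)
      then show ?thesis using f[of 0] assms(1) 1 by (simp add: L_def)
    next
      case 2
      have "of_nat (pochhammer (m + 2) p) / of_nat (pochhammer (m + 2) p) = (1::complex)" for p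
        using poch_pos[of p] by simp
      then show ?thesis using f[of 1] assms(1) 2 by (simp add: L_def)
    next
      case 3
      \<comment> \<open>Convergence at \<open>(1 + R) / 2\<close>, which exceeds 1, gives absolute
        convergence at 1, the majorant for the Weierstrass test on [0, 1].\<close>
      have summ: "summable (\<lambda>p. norm (c p * 1 ^ p))"
      proof (rule powser_insidea)
        show "summable (\<lambda>p. c p * of_real ((1 + R) / 2) ^ p)"
          by (rule sums_summable, rule f) (use assms(1) in \<open>simp del: of_real_add of_real_divide\<close>)
      qed (use assms(1) in \<open>simp del: of_real_add of_real_divide\<close>)
      have "uniform_limit {0..1} (\<lambda>N t. \<Sum>p<N. c p * of_real t ^ p) (\<lambda>t. \<Sum>p. c p * complex_of_real t ^ p) sequentially"
        by (rule Weierstrass_m_test[OF _ summ])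
           (auto simp: norm_mult norm_power intro!: mult_left_le power_le_one)
      then have u: "uniform_limit {0..1} (\<lambda>N t. \<Sum>p<N. c p * of_real t ^ p) (\<lambda>t. f (of_real t)) sequentially"
        by (rule uniform_limit_cong'[THEN iffD1, rotated 2])
           (use assms(1) in \<open>auto intro!: sums_unique[symmetric] f\<close>)
      have cB: "continuous_on {0..1} (\<lambda>t. of_real (Bernstein m j t) :: complex)"
        unfolding Bernstein_def by (intro continuous_intros)
      have u2: "uniform_limit {0..1} (\<lambda>N t. of_real (Bernstein m j t) * (\<Sum>p<N. c p * of_real t ^ p))
          (\<lambda>t. of_real (Bernstein m j t) * f (of_real t)) sequentially"
      proof (rule uniform_lim_mult[OF uniform_limit_const u])
        show "bounded ((\<lambda>t. of_real (Bernstein m j t) :: complex) ` {0..1})"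
          by (intro compact_imp_bounded compact_continuous_image cB compact_Icc)
        \<comment> \<open>The product of uniform limits requires bounded factors; \<open>f\<close>
          is bounded on [0, 1] as a continuous uniform limit of polynomials.\<close>
        have "continuous_on {0..1} (\<lambda>t. f (complex_of_real t))"
          by (rule uniform_limit_theorem[OF _ u]) (auto intro!: always_eventually continuous_intros)
        then show "bounded ((\<lambda>t. f (complex_of_real t)) ` {0..1})"
          by (intro compact_imp_bounded compact_continuous_image compact_Icc)
      qed
      have cont: "continuous_on {0..1} (\<lambda>t. of_real (Bernstein m j t) * (\<Sum>p<N. c p * of_real t ^ p))" for N
        by (intro continuous_intros cB)
      obtain I J where I: "\<And>N. ((\<lambda>t. of_real (Bernstein m j t) * (\<Sum>p<N. c p * of_real t ^ p)) has_integral I N) {0..1}"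
        and J: "((\<lambda>t. of_real (Bernstein m j t) * f (of_real t)) has_integral J) {0..1}"
        and lim: "I \<longlonglongrightarrow> J"
        using uniform_limit_integral[OF u2 cont sequentially_bot] by blast
      have "((\<lambda>t. of_real (Bernstein m j t) * (\<Sum>p<N. c p * of_real t ^ p)) has_integral
          (\<Sum>p<N. c p * (of_nat (pochhammer (Suc j) p) / (of_nat (Suc m) * of_nat (pochhammer (m + 2) p))))) {0..1}" for N
        unfolding sum_distrib_left mult.left_commute[of "of_real _" "c _"]
        using 3 by (intro has_integral_sum has_integral_mult_right[OF Bernstein_moment]) auto
      then have "I = (\<lambda>N. \<Sum>p<N. c p * (of_nat (pochhammer (Suc j) p) / (of_nat (Suc m) * of_nat (pochhammer (m + 2) p))))"
        using I by (intro ext) (rule has_integral_unique)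
      with lim have "(\<lambda>p. c p * (of_nat (pochhammer (Suc j) p) / (of_nat (Suc m) * of_nat (pochhammer (m + 2) p)))) sums J"
        by (simp only: sums_def)
      \<comment> \<open>The prefactor n - 1 = \<open>Suc m\<close> of the operator cancels the one
        in the Beta moment.\<close>
      from sums_mult[OF this, of "of_nat (Suc m)"]
      have "(\<lambda>p. c p * (of_nat (pochhammer (Suc j) p) / of_nat (pochhammer (m + 2) p))) sums (of_nat (Suc m) * J)"
        by (simp add: mult.left_commute del: of_nat_Suc)
      moreover have "L k = of_nat (Suc m) * J"
        using 3 J by (simp add: L_def integral_unique del: of_nat_Suc)
      ultimately show ?thesis using 3 by simp
    qed
  qed
  then have "(\<lambda>p. \<Sum>k\<le>m + 2. alpha_Bernstein \<alpha> (m + 2) k z *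
        (c p * (of_nat (pochhammer k p) / of_nat (pochhammer (m + 2) p))))
      sums (\<Sum>k\<le>m + 2. alpha_Bernstein \<alpha> (m + 2) k z * L k)"
    by (intro sums_sum sums_mult) auto
  moreover have "(\<Sum>k\<le>m + 2. alpha_Bernstein \<alpha> (m + 2) k z * L k) =
      genuine_Bernstein_Durrmeyer \<alpha> (m + 2) f z"
  proof -
    have "{..m + 2} = insert 0 (insert (m + 2) {1..m + 1})" by auto
    then show ?thesis
      by (simp add: L_def genuine_Bernstein_Durrmeyer_def sum_distrib_left algebra_simps)
  qed
  ultimately show ?thesis
    by (simp only: sum_distrib_left mult.left_commute)
qed

section \<open>Asymptotics of the leading weight\<close>

text \<open>
  The coefficients of \<open>z ^ p\<close> and (below, for \<open>p = q + 1\<close>) of \<open>z ^ q\<close> in the image of \<open>z ^ p\<close> under the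
  operator with \<open>\<alpha> = 1\<close>.
\<close>

definition top_weight :: "nat \<Rightarrow> nat \<Rightarrow> real" where
  "top_weight n p = fact p * real (n choose p) / real (pochhammer n p)"

lemma top_weight_0 [simp]: "top_weight n 0 = 1"
  by (simp add: top_weight_def)

text \<open>The new factor is 1 - 2p / (n + p), which makes bounds and limits in \<open>n\<close>
  accessible by induction on \<open>p\<close>.\<close>

lemma top_weight_Suc:
  "top_weight n (Suc p) = top_weight n p * (real n - real p) / (real n + real p)"
proof -
  have "real (Suc p) * real (n choose Suc p) = (real n - real p) * real (n choose p)"
  proof (cases "p \<le> n")
    case True
    then show ?thesis
      by (metis binomial_absorb_comp binomial_absorption of_nat_diff of_nat_mult)
  qed (simp add: binomial_eq_0)
  then have "fact (Suc p) * real (n choose Suc p) = (real n - real p) * (fact p * real (n choose p))"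
    by (metis (no_types, lifting) fact_Suc mult.assoc mult.commute)
  then show ?thesis
    by (simp add: top_weight_def pochhammer_Suc mult.commute)
qed

lemma top_weight_nonneg: "top_weight n p \<ge> 0"
  by (simp add: top_weight_def)

lemma top_weight_le_1: "top_weight n p \<le> 1"
proof (induction p)
  case (Suc p)
  have "(real n - real p) / (real n + real p) \<le> 1" by (simp add: divide_le_eq)
  then have "top_weight n p * ((real n - real p) / (real n + real p)) \<le> 1"
    using Suc top_weight_nonneg[of n p]
    by (meson mult_left_le order_trans)
  then show ?case by (simp add: top_weight_Suc)
qed simp

text \<open>The increment in \<open>p\<close> is at most 2p and tends to 2p, and the sum of 2p over
  p \<le> q is q (q + 1); this produces both the bound and the limit below.\<close>

lemma one_minus_top_weight_Suc:
  assumes "n > 0"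
  shows "real n * (1 - top_weight n (Suc p)) =
    real n * (1 - top_weight n p) + top_weight n p * (2 * real p * real n / (real n + real p))"
  using assms by (simp add: top_weight_Suc field_simps)

lemma one_minus_top_weight_le:
  assumes "n > 0"
  shows "real n * (1 - top_weight n (Suc q)) \<le> real (Suc q) * real q"
proof (induction q)
  case 0
  then show ?case using assms by (simp add: top_weight_Suc)
next
  case (Suc q)
  have "2 * real (Suc q) * real n / (real n + real (Suc q)) \<le> 2 * real (Suc q)"
    using assms by (simp add: field_simps)
  then have "top_weight n (Suc q) * (2 * real (Suc q) * real n / (real n + real (Suc q))) \<le> 2 * real (Suc q)"
    using top_weight_nonneg[of n "Suc q"] top_weight_le_1[of n "Suc q"]
    by (intro order_trans[OF mult_left_le_one_le]) auto
  then show ?case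
    using Suc one_minus_top_weight_Suc[OF assms, of "Suc q"] by (simp add: algebra_simps)
qed

lemma tendsto_ratio: "(\<lambda>n. real n / (real n + real p)) \<longlonglongrightarrow> 1"
proof -
  have "(\<lambda>n. 1 - real p / real (n + p)) \<longlonglongrightarrow> 1 - 0"
    by (intro tendsto_diff tendsto_const LIMSEQ_ignore_initial_segment lim_const_over_n)
  moreover have "\<forall>\<^sub>F n in sequentially. 1 - real p / real (n + p) = real n / (real n + real p)"
    using eventually_gt_at_top[of 0] by eventually_elim (simp add: field_simps)
  ultimately show ?thesis by (simp add: Lim_transform_eventually)
qed

lemma top_weight_tendsto: "(\<lambda>n. top_weight n p) \<longlonglongrightarrow> 1"
proof (induction p)
  case (Suc p)
  have "(\<lambda>n. 2 * (real n / (real n + real p)) - 1) \<longlonglongrightarrow> 2 * 1 - 1"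
    by (intro tendsto_intros tendsto_ratio)
  moreover have "\<forall>\<^sub>F n in sequentially. 2 * (real n / (real n + real p)) - 1 = (real n - real p) / (real n + real p)"
    using eventually_gt_at_top[of 0] by eventually_elim (simp add: field_simps)
  ultimately have "(\<lambda>n. (real n - real p) / (real n + real p)) \<longlonglongrightarrow> 1"
    by (simp add: Lim_transform_eventually)
  from tendsto_mult[OF Suc this] show ?case by (simp add: top_weight_Suc)
qed simp

lemma one_minus_top_weight_tendsto:
  "(\<lambda>n. real n * (1 - top_weight n (Suc q))) \<longlonglongrightarrow> real (Suc q) * real q"
proof (induction q)
  case 0
  have "\<forall>\<^sub>F n in sequentially. real n * (1 - top_weight n (Suc 0)) = 0"
    using eventually_gt_at_top[of 0] by eventually_elim (simp add: top_weight_Suc)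
  then show ?case by (simp add: tendsto_eventually)
next
  case (Suc q)
  have "(\<lambda>n. 2 * real (Suc q) * real n / (real n + real (Suc q))) \<longlonglongrightarrow> 2 * real (Suc q)"
    using tendsto_mult_left[OF tendsto_ratio[of "Suc q"], of "2 * real (Suc q)"] by simp
  from tendsto_add[OF Suc tendsto_mult[OF top_weight_tendsto[of "Suc q"] this]]
  have "(\<lambda>n. real n * (1 - top_weight n (Suc q)) + top_weight n (Suc q) * (2 * real (Suc q) * real n / (real n + real (Suc q))))
     \<longlonglongrightarrow> real (Suc (Suc q)) * real (Suc q)"
    by (simp add: algebra_simps)
  moreover have "\<forall>\<^sub>F n in sequentially. real n * (1 - top_weight n (Suc q)) + top_weight n (Suc q) * (2 * real (Suc q) * real n / (real n + real (Suc q))) = real n * (1 - top_weight n (Suc (Suc q)))"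
    using eventually_gt_at_top[of 0] by eventually_elim (simp only: one_minus_top_weight_Suc)
  ultimately show ?case by (rule Lim_transform_eventually)
qed

section \<open>Error estimates for a single monomial\<close>

text \<open>All three rising factorials contain \<open>pochhammer (k + 2) t\<close>; in the
  remaining quadratic factors everything depending on \<open>k\<close> cancels.\<close>

lemma pochhammer_second_difference:
  "(of_nat (pochhammer k (Suc (Suc t))) - 2 * of_nat (pochhammer (k + 1) (Suc (Suc t)))
     + of_nat (pochhammer (k + 2) (Suc (Suc t))) :: 'a::comm_ring_1) =
   of_nat (Suc (Suc t) * Suc t) * of_nat (pochhammer (k + 2) t)"
proof -
  have "pochhammer k (Suc (Suc t)) = k * (k + 1) * pochhammer (k + 2) t"
    by (simp add: pochhammer_rec[of k] pochhammer_rec[of "Suc k"] algebra_simps)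
  moreover have "pochhammer (k + 1) (Suc (Suc t)) = (k + 1) * (k + t + 2) * pochhammer (k + 2) t"
    by (simp add: pochhammer_rec[of "Suc k" "Suc t"] pochhammer_Suc[of "Suc (Suc k)" t] algebra_simps)
  moreover have "pochhammer (k + 2) (Suc (Suc t)) = (k + t + 2) * (k + t + 3) * pochhammer (k + 2) t"
    by (simp add: pochhammer_Suc algebra_simps)
  ultimately show ?thesis
    by (simp add: algebra_simps)
qed


definition subtop_weight :: "nat \<Rightarrow> nat \<Rightarrow> real" where
  "subtop_weight n q = real (Suc q) * real q * top_weight n q / (real n + real q)"

text \<open>The exponent is p = q + 1. The first two terms are the deviations of the scaled leading
  weights from their common limit; the third is \<open>n\<close> times the total weight of the
  powers below \<open>z ^ q\<close>, as all weights sum to 1.\<close>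

definition weight_error :: "nat \<Rightarrow> nat \<Rightarrow> real" where
  "weight_error n q =
     \<bar>real n * (1 - top_weight n (Suc q)) - real (Suc q) * real q\<bar>
     + \<bar>real n * subtop_weight n q - real (Suc q) * real q\<bar>
     + \<bar>real n * (1 - top_weight n (Suc q)) - real n * subtop_weight n q\<bar>"

text \<open>The sum is 1 by Vandermonde with k = n. The lower weights stay anonymous because only
  their sign and their total enter the estimates.\<close>

lemma Bernstein_weights:
  assumes "n > 0"
  shows "\<exists>W :: nat \<Rightarrow> real. (\<forall>j. W j \<ge> 0) \<and>
    (\<Sum>j<q. W j) + subtop_weight n q + top_weight n (Suc q) = 1 \<and>
    (\<forall>z :: complex. Bernstein_sum n (\<lambda>k. of_nat (pochhammer k (Suc q))) z / of_nat (pochhammer n (Suc q)) =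
       (\<Sum>j<q. of_real (W j) * z ^ j) + of_real (subtop_weight n q) * z ^ q
       + of_real (top_weight n (Suc q)) * z ^ Suc q)"
proof -
  define W where "W j = real (fact (Suc q) * (q choose (Suc q - j)) * (n choose j)) / real (pochhammer n (Suc q))" for j
  have pos: "pochhammer n (Suc q) > 0"
    using assms by (intro pochhammer_pos)
  have W_top: "W (Suc q) = top_weight n (Suc q)"
    unfolding W_def top_weight_def by (simp del: fact_Suc)
  have W_sub: "W q = subtop_weight n q"
    by (simp add: W_def subtop_weight_def top_weight_def pochhammer_Suc algebra_simps)
  have split: "(\<Sum>j\<le>Suc q. h j) = (\<Sum>j<q. h j) + h q + h (Suc q)" for h :: "nat \<Rightarrow> 'b::comm_monoid_add"
    by (simp flip: lessThan_Suc_atMost)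
  have "(\<Sum>j\<le>Suc q. W j) = real (fact (Suc q) * (\<Sum>j\<le>Suc q. (n choose j) * (q choose (Suc q - j)))) / real (pochhammer n (Suc q))"
    unfolding W_def sum_distrib_left sum_divide_distrib of_nat_sum by (simp only: mult_ac)
  also have "fact (Suc q) * (\<Sum>j\<le>Suc q. (n choose j) * (q choose (Suc q - j))) = pochhammer n (Suc q)"
    using pochhammer_nat_eq_sum[of 0 "Suc q" q n] by (simp only: add_0 add_0_right)
  also have "real \<dots> / real \<dots> = 1"
    using pos by simp
  finally have 1: "(\<Sum>j<q. W j) + subtop_weight n q + top_weight n (Suc q) = 1"
    by (simp only: split W_top W_sub)
  have 2: "Bernstein_sum n (\<lambda>k. of_nat (pochhammer k (Suc q))) z / of_nat (pochhammer n (Suc q)) =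
       (\<Sum>j<q. of_real (W j) * z ^ j) + of_real (subtop_weight n q) * z ^ q
       + of_real (top_weight n (Suc q)) * z ^ Suc q" for z :: complex
  proof -
    have "Bernstein_sum n (\<lambda>k. of_nat (pochhammer k (Suc q))) z / of_nat (pochhammer n (Suc q)) =
        (\<Sum>j\<le>Suc q. of_real (W j) * z ^ j)"
      using Bernstein_sum_pochhammer[of 0 "Suc q" q n z]
      by (simp add: W_def sum_divide_distrib add_divide_distrib)
    then show ?thesis by (simp only: split W_top W_sub)
  qed
  show ?thesis by (intro exI[of _ W] conjI allI 1 2) (simp add: W_def)
qed

lemma norm_Bernstein_part_le:
  fixes z :: complex
  assumes "n > 0" "norm z \<le> r" "1 \<le> r"
  shows "norm (of_nat n * (Bernstein_sum n (\<lambda>k. of_nat (pochhammer k (Suc q))) z / of_nat (pochhammer n (Suc q)) - z ^ Suc q)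
      - of_nat (Suc q * q) * z ^ q * (1 - z)) \<le> r ^ Suc q * weight_error n q"
proof -
  obtain W :: "nat \<Rightarrow> real" where W: "\<forall>j. W j \<ge> 0"
    "(\<Sum>j<q. W j) + subtop_weight n q + top_weight n (Suc q) = 1"
    "\<forall>z :: complex. Bernstein_sum n (\<lambda>k. of_nat (pochhammer k (Suc q))) z / of_nat (pochhammer n (Suc q)) =
       (\<Sum>j<q. of_real (W j) * z ^ j) + of_real (subtop_weight n q) * z ^ q
       + of_real (top_weight n (Suc q)) * z ^ Suc q"
    using Bernstein_weights[OF assms(1), of q] by (elim exE conjE) (rule that)
  let ?P = "real (Suc q) * real q"
  have pow: "norm (z ^ j) \<le> r ^ Suc q" if "j \<le> Suc q" for j
  proof -
    have "norm (z ^ j) \<le> r ^ j" by (simp add: norm_power power_mono assms)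
    also have "\<dots> \<le> r ^ Suc q" using assms that by (intro power_increasing)
    finally show ?thesis .
  qed
  have term_le: "norm (of_real a * z ^ j) \<le> r ^ Suc q * \<bar>a\<bar>" if "j \<le> Suc q" for a j
    using mult_left_mono[OF pow[OF that], of "\<bar>a\<bar>"] by (simp add: norm_mult mult.commute)
  \<comment> \<open>Splitting \<open>z ^ q * (1 - z)\<close> and collecting powers leaves
    coefficients of \<open>z ^ Suc q\<close> and \<open>z ^ q\<close> that are exactly the
    deviations in \<open>weight_error\<close>.\<close>
  have eq: "of_nat n * (Bernstein_sum n (\<lambda>k. of_nat (pochhammer k (Suc q))) z / of_nat (pochhammer n (Suc q)) - z ^ Suc q)
      - of_nat (Suc q * q) * z ^ q * (1 - z) =
      of_real (- (real n * (1 - top_weight n (Suc q)) - ?P)) * z ^ Suc q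
      + of_real (real n * subtop_weight n q - ?P) * z ^ q
      + of_nat n * (\<Sum>j<q. of_real (W j) * z ^ j)"
  proof -
    have "N * ((S + v * y + w * x) - x) - Q * y * (1 - z) =
        - (N * (1 - w) - Q) * x + (N * v - Q) * y + N * S"
      if "x = z * y" for N S v w y x Q :: complex
      using that by (simp add: algebra_simps)
    from this[OF power_Suc] show ?thesis
      unfolding W(3)[rule_format]
      by (simp only: of_real_minus of_real_diff of_real_mult of_real_of_nat_eq of_real_1 of_nat_mult)
  qed
  have "norm (of_real (- (real n * (1 - top_weight n (Suc q)) - ?P)) * z ^ Suc q
      + of_real (real n * subtop_weight n q - ?P) * z ^ q
      + of_nat n * (\<Sum>j<q. of_real (W j) * z ^ j))
      \<le> r ^ Suc q * \<bar>- (real n * (1 - top_weight n (Suc q)) - ?P)\<bar>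
      + r ^ Suc q * \<bar>real n * subtop_weight n q - ?P\<bar>
      + r ^ Suc q * \<bar>real n * (1 - top_weight n (Suc q)) - real n * subtop_weight n q\<bar>"
  proof (intro norm_triangle_mono term_le)
    have "norm (\<Sum>j<q. of_real (W j) * z ^ j) \<le> (\<Sum>j<q. r ^ Suc q * W j)"
      using W(1) by (intro sum_norm_le order_trans[OF term_le]) auto
    also have "\<dots> = r ^ Suc q * (1 - top_weight n (Suc q) - subtop_weight n q)"
    proof -
      have "(\<Sum>j<q. W j) = 1 - top_weight n (Suc q) - subtop_weight n q"
        using W(2) by linarith
      then show ?thesis by (simp only: flip: sum_distrib_left)
    qed
    finally have "real n * norm (\<Sum>j<q. of_real (W j) * z ^ j)
        \<le> real n * (r ^ Suc q * (1 - top_weight n (Suc q) - subtop_weight n q))"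
      by (intro mult_left_mono) auto
    also have "\<dots> = r ^ Suc q * (real n * (1 - top_weight n (Suc q)) - real n * subtop_weight n q)"
      by (simp only: algebra_simps)
    also have "\<dots> \<le> r ^ Suc q * \<bar>real n * (1 - top_weight n (Suc q)) - real n * subtop_weight n q\<bar>"
      using assms by (intro mult_left_mono) auto
    finally show "norm (of_nat n * (\<Sum>j<q. of_real (W j) * z ^ j))
        \<le> r ^ Suc q * \<bar>real n * (1 - top_weight n (Suc q)) - real n * subtop_weight n q\<bar>"
      by (simp add: norm_mult)
  qed auto
  also have "\<dots> = r ^ Suc q * weight_error n q"
    by (simp only: weight_error_def abs_minus_cancel distrib_left)
  finally show ?thesis unfolding eq .
qed

lemma weight_error_nonneg: "weight_error n q \<ge> 0"
  by (simp add: weight_error_def)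

text \<open>Both scaled quantities lie between 0 and q (q + 1), so each of the three distances is at
  most q (q + 1).\<close>

lemma weight_error_le:
  assumes "n > 0"
  shows "weight_error n q \<le> 3 * (real (Suc q) * real q)"
proof -
  obtain W :: "nat \<Rightarrow> real" where W: "\<forall>j. W j \<ge> 0"
    "(\<Sum>j<q. W j) + subtop_weight n q + top_weight n (Suc q) = 1"
    using Bernstein_weights[OF assms, of q] by blast
  have "(\<Sum>j<q. W j) \<ge> 0" using W(1) by (simp add: sum_nonneg)
  with W(2) have "subtop_weight n q \<le> 1 - top_weight n (Suc q)" by linarith
  then have "real n * subtop_weight n q \<le> real n * (1 - top_weight n (Suc q))"
    by (rule mult_left_mono) simp
  moreover have "real n * subtop_weight n q \<ge> 0"
    by (simp add: subtop_weight_def top_weight_nonneg)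
  ultimately show ?thesis
    using one_minus_top_weight_le[OF assms, of q] unfolding weight_error_def by linarith
qed

lemma weight_error_tendsto: "(\<lambda>n. weight_error n q) \<longlonglongrightarrow> 0"
proof -
  let ?P = "real (Suc q) * real q"
  have "(\<lambda>n. ?P * (top_weight n q * (real n / (real n + real q)))) \<longlonglongrightarrow> ?P * (1 * 1)"
    by (intro tendsto_intros top_weight_tendsto tendsto_ratio)
  then have sub: "(\<lambda>n. real n * subtop_weight n q) \<longlonglongrightarrow> ?P"
    by (simp add: subtop_weight_def mult_ac)
  have "(\<lambda>n. weight_error n q) \<longlonglongrightarrow> \<bar>?P - ?P\<bar> + \<bar>?P - ?P\<bar> + \<bar>?P - ?P\<bar>"
    unfolding weight_error_def
    by (intro tendsto_add tendsto_rabs tendsto_diff sub one_minus_top_weight_tendsto tendsto_const)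
  then show ?thesis by simp
qed

text \<open>The second difference lowers the degree of the rising factorial by two, and
  \<open>pochhammer n t / pochhammer n (t + 2)\<close> is at most 1 / n^2; the factor
  \<open>n\<close> in front leaves 1 / n.\<close>

lemma norm_alpha_part_le:
  fixes z :: complex
  assumes "norm z \<le> r" "1 \<le> r"
  shows "norm (of_nat (m + 2) * (z * (1 - z) *
      Bernstein_sum m (\<lambda>k. of_nat (pochhammer k (Suc q)) - 2 * of_nat (pochhammer (k + 1) (Suc q))
        + of_nat (pochhammer (k + 2) (Suc q))) z / of_nat (pochhammer (m + 2) (Suc q))))
    \<le> r ^ Suc q * (r * (1 + r) * (real (Suc q) * real q) / real (m + 2))"
proof (cases q)
  case 0
  \<comment> \<open>For exponent 1 the second difference of a linear sequence vanishes.\<close>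
  then show ?thesis by (simp add: Bernstein_sum_def)
next
  case (Suc t)
  define n where "n = m + 2"
  define P where "P = real (Suc (Suc t) * Suc t)"
  define B where "B = Bernstein_sum m (\<lambda>k. of_nat (pochhammer (k + 2) t)) z"
  have pos: "real (pochhammer n i) > 0" for i
    by (simp add: n_def pochhammer_pos)
  have n: "real n > 0" by (simp add: n_def)
  have "norm B \<le> r ^ t * real (pochhammer n t)"
    unfolding B_def n_def by (rule norm_Bernstein_sum_pochhammer_le[of 2 t "t + 1"]) (use assms in auto)
  also have "\<dots> \<le> r ^ Suc q * real (pochhammer n t)"
    using Suc assms by (intro mult_right_mono power_increasing) auto
  finally have B: "norm B \<le> r ^ Suc q * real (pochhammer n t)" .
  have "norm (1 - z) \<le> 1 + r"
    using norm_triangle_ineq4[of 1 z] assms by simp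
  then have zz: "norm (z * (1 - z)) \<le> r * (1 + r)"
    unfolding norm_mult using assms by (intro mult_mono) auto
  have poch: "real n * real n * real (pochhammer n t) \<le> real (pochhammer n (Suc (Suc t)))"
  proof -
    have "n * n * pochhammer n t \<le> (n + t) * (n + t + 1) * pochhammer n t"
      by (intro mult_mono) auto
    also have "\<dots> = pochhammer n (Suc (Suc t))"
      by (simp add: pochhammer_Suc mult_ac)
    finally show ?thesis by (metis of_nat_le_iff of_nat_mult)
  qed
  have "norm (of_nat n * (z * (1 - z) * (of_nat (Suc (Suc t) * Suc t) * B) / of_nat (pochhammer n (Suc q))))
      = real n * P * (norm (z * (1 - z)) * norm B) / real (pochhammer n (Suc (Suc t)))"
    unfolding Suc P_def by (simp only: norm_mult norm_divide norm_of_nat mult_ac times_divide_eq_right)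
  also have "\<dots> \<le> real n * P * (r * (1 + r) * (r ^ Suc q * real (pochhammer n t))) / real (pochhammer n (Suc (Suc t)))"
    using assms pos by (intro divide_right_mono mult_left_mono mult_mono zz B) (auto simp: P_def)
  also have "\<dots> = P * (r * (1 + r) * r ^ Suc q) * (real n * real (pochhammer n t) / real (pochhammer n (Suc (Suc t))))"
    by (simp only: mult_ac times_divide_eq_right)
  also have "\<dots> \<le> P * (r * (1 + r) * r ^ Suc q) * (1 / real n)"
  proof (intro mult_left_mono)
    show "real n * real (pochhammer n t) / real (pochhammer n (Suc (Suc t))) \<le> 1 / real n"
      using poch pos[of "Suc (Suc t)"] n by (simp add: divide_simps mult_ac)
  qed (use assms in \<open>auto simp: P_def\<close>)
  also have "\<dots> = r ^ Suc q * (r * (1 + r) * (real (Suc q) * real q) / real n)"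
    unfolding Suc P_def of_nat_mult by (simp only: mult_ac times_divide_eq_right times_divide_eq_left mult_1_right)
  finally show ?thesis
    unfolding Suc pochhammer_second_difference Bernstein_sum_scale
    unfolding Suc B_def n_def .
qed


section \<open>Summation over the coefficients of the power series\<close>

text \<open>Hypothesis and conclusion have the same shape, so a second application yields the series
  of f''.\<close>

lemma power_series_deriv_sums:
  fixes c :: "nat \<Rightarrow> 'a::{banach,real_normed_field}"
  assumes f: "\<And>z. norm z < R \<Longrightarrow> (\<lambda>p. c p * z ^ p) sums f z" and z: "norm z < R"
  shows "(\<lambda>p. diffs c p * z ^ p) sums deriv f z"
proof (rule termdiffs_sums_strong[OF f _ z])
  have "((\<lambda>z. \<Sum>p. c p * z ^ p) has_field_derivative (\<Sum>p. diffs c p * z ^ p)) (at z)"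
    by (rule termdiffs_strong'[OF _ z]) (rule sums_summable[OF f])
  then have "(f has_field_derivative (\<Sum>p. diffs c p * z ^ p)) (at z)"
    by (rule has_field_derivative_transform_within_open[where S = "ball 0 R"])
       (use z in \<open>auto intro!: sums_unique[symmetric] f\<close>)
  then show "(f has_field_derivative deriv f z) (at z)"
    by (simp add: DERIV_imp_deriv)
qed

lemma alpha_moment_error:
  fixes z :: complex
  assumes "0 \<le> \<alpha>" "\<alpha> \<le> 1" "norm z \<le> r" "1 \<le> r"
  shows "norm (of_nat (m + 2) * ((\<Sum>k\<le>m + 2. alpha_Bernstein \<alpha> (m + 2) k z *
        (of_nat (pochhammer k (Suc q)) / of_nat (pochhammer (m + 2) (Suc q)))) - z ^ Suc q)
      - of_nat (Suc q * q) * z ^ q * (1 - z))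
    \<le> r ^ Suc q * (weight_error (m + 2) q + r * (1 + r) * (real (Suc q) * real q) / real (m + 2))"
proof -
  let ?N = "of_nat (m + 2) :: complex" and ?D = "of_nat (pochhammer (m + 2) (Suc q)) :: complex"
  let ?X = "Bernstein_sum (m + 2) (\<lambda>k. of_nat (pochhammer k (Suc q))) z"
  let ?Y = "Bernstein_sum m (\<lambda>k. of_nat (pochhammer k (Suc q)) - 2 * of_nat (pochhammer (k + 1) (Suc q))
        + of_nat (pochhammer (k + 2) (Suc q))) z"
  have "(\<Sum>k\<le>m + 2. alpha_Bernstein \<alpha> (m + 2) k z * (of_nat (pochhammer k (Suc q)) / ?D)) =
      (\<Sum>k\<le>m + 2. alpha_Bernstein \<alpha> (m + 2) k z * of_nat (pochhammer k (Suc q))) / ?D"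
    by (simp only: sum_divide_distrib times_divide_eq_right)
  also have "\<dots> = ?X / ?D + of_real (1 - \<alpha>) * (z * (1 - z) * ?Y / ?D)"
    unfolding sum_alpha_Bernstein by (simp only: add_divide_distrib times_divide_eq_right mult.assoc)
  finally have "?N * ((\<Sum>k\<le>m + 2. alpha_Bernstein \<alpha> (m + 2) k z * (of_nat (pochhammer k (Suc q)) / ?D)) - z ^ Suc q)
      - of_nat (Suc q * q) * z ^ q * (1 - z) =
      (?N * (?X / ?D - z ^ Suc q) - of_nat (Suc q * q) * z ^ q * (1 - z))
      + of_real (1 - \<alpha>) * (?N * (z * (1 - z) * ?Y / ?D))"
    by (simp only: algebra_simps)
  also have "norm \<dots> \<le> r ^ Suc q * weight_error (m + 2) q
      + r ^ Suc q * (r * (1 + r) * (real (Suc q) * real q) / real (m + 2))"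
  proof (intro norm_triangle_mono norm_Bernstein_part_le)
    have "norm (of_real (1 - \<alpha>) * (?N * (z * (1 - z) * ?Y / ?D))) \<le> norm (?N * (z * (1 - z) * ?Y / ?D))"
      using assms(1,2) unfolding norm_mult[of "of_real _"]
      by (intro mult_left_le_one_le) (auto simp del: of_real_diff)
    also have "\<dots> \<le> r ^ Suc q * (r * (1 + r) * (real (Suc q) * real q) / real (m + 2))"
      by (rule norm_alpha_part_le) (use assms in auto)
    finally show "norm (of_real (1 - \<alpha>) * (?N * (z * (1 - z) * ?Y / ?D)))
        \<le> r ^ Suc q * (r * (1 + r) * (real (Suc q) * real q) / real (m + 2))" .
  qed (use assms in auto)
  also have "\<dots> = r ^ Suc q * (weight_error (m + 2) q + r * (1 + r) * (real (Suc q) * real q) / real (m + 2))"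
    by (simp only: distrib_left)
  finally show ?thesis .
qed

theorem theorem2:
  fixes R r \<alpha> :: real and f :: "complex \<Rightarrow> complex" and c :: "nat \<Rightarrow> complex"
  assumes "R > 1" and "1 \<le> r" and "r < R"
    and "\<And>z. norm z < R \<Longrightarrow> (\<lambda>p. c p * z ^ p) sums f z"
    and "0 \<le> \<alpha>" and "\<alpha> \<le> 1"
  shows "uniform_limit (cball 0 r)
           (\<lambda>n z. of_nat n * (genuine_Bernstein_Durrmeyer \<alpha> n f z - f z))
           (\<lambda>z. z * (1 - z) * (deriv ^^ 2) f z) sequentially"
proof -
  \<comment> \<open>Indices are shifted to p = q + 1, since constants are reproduced exactly;
    \<open>P q\<close> is then p (p - 1).\<close>
  define A where "A q = norm (c (Suc q)) * r ^ Suc q" for q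
  define P where "P q = real (Suc q) * real q" for q
  define E where "E n q = weight_error n q + r * (1 + r) * P q / real n" for n q
  have A_nonneg: "A q \<ge> 0" for q using assms(2) by (simp add: A_def)
  have E_nonneg: "E n q \<ge> 0" for n q
    using assms(2) weight_error_nonneg[of n q] by (simp add: E_def P_def)
  have f': "(\<lambda>p. diffs c p * z ^ p) sums deriv f z" if "norm z < R" for z
    by (rule power_series_deriv_sums[OF assms(4) that])
  have f'': "(\<lambda>p. diffs (diffs c) p * z ^ p) sums deriv (deriv f) z" if "norm z < R" for z
    by (rule power_series_deriv_sums[OF f' that])
  have diffs2: "diffs (diffs c) p = of_nat (Suc (Suc p) * Suc p) * c (Suc (Suc p))" for p
    by (simp only: diffs_def of_nat_mult mult_ac)
  \<comment> \<open>Up to an index shift and the factor r^2 this is the absolute series of f'' at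
    \<open>r\<close>, which converges because the series converges at
    \<open>(r + R) / 2\<close>.\<close>
  have AP: "summable (\<lambda>q. A q * P q)"
  proof -
    have "summable (\<lambda>p. norm (diffs (diffs c) p * of_real r ^ p))"
    proof (rule powser_insidea)
      show "summable (\<lambda>p. diffs (diffs c) p * of_real ((r + R) / 2) ^ p)"
        by (rule sums_summable, rule f'') (use assms in \<open>simp del: of_real_add of_real_divide\<close>)
    qed (use assms in \<open>simp del: of_real_add of_real_divide\<close>)
    then have "summable (\<lambda>p. norm (diffs (diffs c) p * of_real r ^ p) * r\<^sup>2)"
      by (rule summable_mult2)
    moreover have "norm (diffs (diffs c) p * of_real r ^ p) * r\<^sup>2 = A (Suc p) * P (Suc p)" for p
      unfolding diffs2 norm_mult norm_power norm_of_nat A_def P_def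
      using assms(2) by (simp add: power2_eq_square algebra_simps)
    ultimately show ?thesis by (subst summable_Suc_iff[symmetric]) simp
  qed
  \<comment> \<open>The 3 comes from \<open>weight_error_le\<close>, and \<open>r * (1 + r)\<close>
    from the second difference part with 1 / n \<le> 1.\<close>
  have AE_le: "A q * E n q \<le> (3 + r * (1 + r)) * (A q * P q)" if "n \<ge> 1" for n q
  proof -
    have "0 \<le> r * (1 + r) * P q"
      using assms(2) by (simp add: P_def)
    then have "r * (1 + r) * P q / real n \<le> r * (1 + r) * P q"
      using that divide_left_mono[of 1 "real n" "r * (1 + r) * P q"] by simp
    then have "E n q \<le> (3 + r * (1 + r)) * P q"
      using weight_error_le[of n q] that unfolding E_def P_def distrib_right by linarith
    from mult_left_mono[OF this A_nonneg[of q]] show ?thesis by (simp only: mult_ac)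
  qed
  have dom: "summable (\<lambda>q. (3 + r * (1 + r)) * (A q * P q))"
    by (rule summable_mult[OF AP])
  have AE_summable: "summable (\<lambda>q. A q * E n q)" if "n \<ge> 1" for n
    by (rule summable_comparison_test'[OF dom]) (use AE_le[OF that] A_nonneg E_nonneg in simp)
  \<comment> \<open>The right-hand side is independent of \<open>z\<close>, so uniform convergence
    reduces to a limit of real numbers.\<close>
  have bound: "norm (of_nat n * (genuine_Bernstein_Durrmeyer \<alpha> n f z - f z) - z * (1 - z) * (deriv ^^ 2) f z)
      \<le> (\<Sum>q. A q * E n q)" if n: "n \<ge> 2" and z: "norm z \<le> r" for n z
  proof -
    define m where "m = n - 2"
    have n_eq: "n = m + 2" using n by (simp add: m_def)
    have zR: "norm z < R" using z assms(3) by simp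
    define M where "M p = (\<Sum>k\<le>m + 2. alpha_Bernstein \<alpha> (m + 2) k z *
             (of_nat (pochhammer k p) / of_nat (pochhammer (m + 2) p)))" for p
    \<comment> \<open>The second difference of a constant sequence is zero.\<close>
    have M0: "M 0 = 1"
      using sum_alpha_Bernstein[of \<alpha> m z "\<lambda>_. 1"] Bernstein_sum_choose[of "m + 2" 0 z]
      by (simp add: M_def Bernstein_sum_def)
    have "(\<lambda>p. of_nat n * (c p * M p - c p * z ^ p)) sums
        (of_nat n * (genuine_Bernstein_Durrmeyer \<alpha> n f z - f z))"
      unfolding n_eq M_def
      by (intro sums_mult sums_diff genuine_Bernstein_Durrmeyer_sums[OF assms(1,4)] assms(4) zR)
    then have 1: "(\<lambda>q. of_nat n * (c (Suc q) * M (Suc q) - c (Suc q) * z ^ Suc q)) sums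
        (of_nat n * (genuine_Bernstein_Durrmeyer \<alpha> n f z - f z))"
      by (subst sums_Suc_iff) (simp add: M0)
    have "(\<lambda>p. z * (1 - z) * (diffs (diffs c) p * z ^ p)) sums (z * (1 - z) * (deriv ^^ 2) f z)"
      using f''[OF zR] by (simp add: numeral_2_eq_2 sums_mult)
    then have "(\<lambda>p. c (Suc (Suc p)) * (of_nat (Suc (Suc p) * Suc p) * z ^ Suc p * (1 - z))) sums
        (z * (1 - z) * (deriv ^^ 2) f z)"
      unfolding diffs2 power_Suc by (simp only: mult_ac)
    \<comment> \<open>The added term at \<open>q = 0\<close> vanishes because of the factor
      \<open>q\<close>.\<close>
    then have 2: "(\<lambda>q. c (Suc q) * (of_nat (Suc q * q) * z ^ q * (1 - z))) sums
        (z * (1 - z) * (deriv ^^ 2) f z)"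
      by (subst (asm) sums_Suc_iff) simp
    let ?e = "\<lambda>q. of_nat n * (M (Suc q) - z ^ Suc q) - of_nat (Suc q * q) * z ^ q * (1 - z)"
    have sums: "(\<lambda>q. c (Suc q) * ?e q) sums
      (of_nat n * (genuine_Bernstein_Durrmeyer \<alpha> n f z - f z) - z * (1 - z) * (deriv ^^ 2) f z)"
      using sums_diff[OF 1 2] by (simp only: algebra_simps)
    have "norm (c (Suc q) * ?e q) \<le> A q * E n q" for q
    proof -
      have "norm (?e q) \<le> r ^ Suc q * E n q"
        unfolding n_eq M_def E_def P_def
        by (rule alpha_moment_error) (use assms z in auto)
      from mult_left_mono[OF this norm_ge_zero[of "c (Suc q)"]] show ?thesis
        by (simp only: norm_mult A_def mult.assoc)
    qed
    then have "norm (\<Sum>q. c (Suc q) * ?e q) \<le> (\<Sum>q. A q * E n q)"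
      using n by (intro norm_suminf_le AE_summable) auto
    then show ?thesis using sums_unique[OF sums] by simp
  qed
  have "(\<lambda>n. A q * E n q) \<longlonglongrightarrow> A q * (0 + 0)" for q
    unfolding E_def by (intro tendsto_intros weight_error_tendsto lim_const_over_n)
  then have lim: "(\<lambda>n. A q * E n q) \<longlonglongrightarrow> 0" for q
    by simp
  \<comment> \<open>The majorant holds for every \<open>q\<close> once \<open>n \<ge> 1\<close>,
    giving the domination required by Tannery's theorem.\<close>
  have "\<forall>\<^sub>F (q, n) in at_top \<times>\<^sub>F sequentially. norm (A q * E n q) \<le> (3 + r * (1 + r)) * (A q * P q)"
    unfolding eventually_prod_filter
    using AE_le A_nonneg E_nonneg eventually_ge_at_top[of "1::nat"]
    by (intro exI[of _ "\<lambda>_. True"] exI[of _ "\<lambda>n. n \<ge> 1"]) auto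
  from tannerys_theorem[OF lim this dom sequentially_bot]
  have T: "(\<lambda>n. \<Sum>q. A q * E n q) \<longlonglongrightarrow> 0" by simp
  show ?thesis
  proof (rule uniform_limitI)
    fix e :: real assume "e > 0"
    have "\<forall>\<^sub>F n in sequentially. (\<Sum>q. A q * E n q) < e"
      using T \<open>e > 0\<close> by (rule order_tendstoD)
    then show "\<forall>\<^sub>F n in sequentially. \<forall>z\<in>cball 0 r.
        dist (of_nat n * (genuine_Bernstein_Durrmeyer \<alpha> n f z - f z)) (z * (1 - z) * (deriv ^^ 2) f z) < e"
      using eventually_ge_at_top[of "2::nat"]
      by eventually_elim (use bound in \<open>fastforce simp: dist_norm\<close>)
  qed
qed

end
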